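(* Let $G$ be a finite group, $q=|G|$, and let $m\ge 1$, $2\le k\le |G|$ be integers. Let $X$ be a paracompact fixed point free $G$-space with $g_G(X)>(|G|-1)(m-1)+k-1$, and let $f_1:X\to\mathbb R$ and $h:X\to\mathbb R^{m-1}$ be continuous maps. Then $$g_G(A(f_1\oplus h,k))\ge g_G(A'(f_1,k)\cap A(h,q))\ge g_G(X)-(|G|-1)(m-1)-k+1.$$
   Context: A $G$-space is a topological space with a continuous left action of the finite group $G$; it is fixed point free if no point is fixed by all of $G$. $f_1\oplus h:X\to\mathbb R\oplus\mathbb R^{m-1}=\mathbb R^m$ is the map with components $(f_1,h)$. For a $G$-space $X$ and a continuous map $f:X\to Y$, $$A(f,k)=\{x\in X:\ \exists\text{ distinct } g_1,\dots,g_k\in G\text{ such that } f(g_1x)=\dots=f(g_kx)\}.$$ For a continuous function $f:X\to\mathbb R$, $$A'(f,k)=\{x\in X:\ \exists\text{ distinct } g_1,\dots,g_k\in G\text{ and } c\in\mathbb R\text{ such that } f(g_1x)=\dots=f(g_kx)=c\text{ and } f(gx)\le c\ \ \forall g\in G\}.$$ The fixed point free genus: let $D_G$ be the (discrete) disjoint union of all orbits $G/H$, where $H$ runs over the subgroups of $G$ with $H\ne G$. For a fixed point free $G$-space $X$, $g_G(X)$ is the least $n\ge0$ such that $X$ can be covered by $n$ ($G$-invariant) open subsets $X_1,\dots,X_n$ each of which admits a $G$-equivariant continuous map $X_i\to D_G$. It is $\infty$ if there is no such $n$, and the empty space has genus $0$. (For paracompact $X$ this is equivalent to the existence of a $G$-map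 from $X$ to the $n$-fold join $D_G*\dots*D_G$.) *)

theory Defs
  imports
    "HOL-Algebra.Group_Action"
    "HOL-Algebra.Left_Coset"
    "HOL-Analysis.Abstract_Euclidean_Space"
    "HOL-Library.Extended_Nat"
begin

text \<open>The Hausdorff axiom is part of the notion, as usual; without it, paracompactness
  gives no partitions of unity.\<close>

definition paracompact_space :: "'x topology \<Rightarrow> bool" where
  "paracompact_space X \<longleftrightarrow>
     Hausdorff_space X \<and>
     (\<forall>\<U>. (\<forall>U\<in>\<U>. openin X U) \<and> \<Union>\<U> = topspace X \<longrightarrow>
       (\<exists>\<V>. (\<forall>V\<in>\<V>. openin X V) \<and> \<Union>\<V> = topspace X \<and>
            (\<forall>V\<in>\<V>. \<exists>U\<in>\<U>. V \<subseteq> U) \<and> locally_finite_in X \<V>))"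

text \<open>The group is discrete, so joint continuity of the action means continuity of
  each translation.\<close>

definition G_space :: "('g, 'b) monoid_scheme \<Rightarrow> 'x topology \<Rightarrow> ('g \<Rightarrow> 'x \<Rightarrow> 'x) \<Rightarrow> bool" where
  "G_space G X \<phi> \<longleftrightarrow>
     group_action G (topspace X) \<phi> \<and> (\<forall>g\<in>carrier G. continuous_map X X (\<phi> g))"

definition fixed_point_free ::
    "('g, 'b) monoid_scheme \<Rightarrow> 'x topology \<Rightarrow> ('g \<Rightarrow> 'x \<Rightarrow> 'x) \<Rightarrow> bool" where
  "fixed_point_free G X \<phi> \<longleftrightarrow> \<not> (\<exists>x\<in>topspace X. \<forall>g\<in>carrier G. \<phi> g x = x)"

text \<open>The point \<open>aH\<close> of the summand \<open>G/H\<close> of \<open>D\<^sub>G\<close> is encoded as the pair \<open>(H, aH)\<close>.\<close>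

definition orbit_sum :: "('g, 'b) monoid_scheme \<Rightarrow> ('g set \<times> 'g set) set" where
  "orbit_sum G = (SIGMA H:{H. subgroup H G \<and> H \<noteq> carrier G}. lcosets\<^bsub>G\<^esub> H)"

definition orbit_sum_action ::
    "('g, 'b) monoid_scheme \<Rightarrow> 'g \<Rightarrow> 'g set \<times> 'g set \<Rightarrow> 'g set \<times> 'g set" where
  "orbit_sum_action G g = (\<lambda>(H, C). (H, g <#\<^bsub>G\<^esub> C))"

definition admits_map_to_orbit_sum ::
    "('g, 'b) monoid_scheme \<Rightarrow> ('g \<Rightarrow> 'x \<Rightarrow> 'x) \<Rightarrow> 'x topology \<Rightarrow> bool" where
  "admits_map_to_orbit_sum G \<phi> U \<longleftrightarrow>
     (\<exists>F. continuous_map U (discrete_topology (orbit_sum G)) F \<and>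
          (\<forall>g\<in>carrier G. \<forall>x\<in>topspace U. F (\<phi> g x) = orbit_sum_action G g (F x)))"

text \<open>Only the values of \<open>\<phi>\<close> on \<open>topspace X\<close> matter, so for an invariant subset \<open>A\<close> of a
  \<open>G\<close>-space \<open>X\<close> the genus of \<open>A\<close> is \<open>genus G \<phi> (subtopology X A)\<close>, with the same \<open>\<phi>\<close>.
  The infimum of the empty set is \<open>\<infinity>\<close>.\<close>

definition genus ::
    "('g, 'b) monoid_scheme \<Rightarrow> ('g \<Rightarrow> 'x \<Rightarrow> 'x) \<Rightarrow> 'x topology \<Rightarrow> enat" where
  "genus G \<phi> X = Inf {enat n | n. \<exists>U :: nat \<Rightarrow> 'x set.
      (\<Union>i\<in>{1..n}. U i) = topspace X \<and>
      (\<forall>i\<in>{1..n}. openin X (U i) \<and>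
         (\<forall>g\<in>carrier G. \<phi> g ` U i \<subseteq> U i) \<and>
         admits_map_to_orbit_sum G \<phi> (subtopology X (U i)))}"

definition A_set ::
    "('g, 'b) monoid_scheme \<Rightarrow> 'x topology \<Rightarrow> ('g \<Rightarrow> 'x \<Rightarrow> 'x) \<Rightarrow> ('x \<Rightarrow> 'y) \<Rightarrow> nat \<Rightarrow> 'x set" where
  "A_set G X \<phi> f k = {x \<in> topspace X. \<exists>g :: nat \<Rightarrow> 'g.
      inj_on g {1..k} \<and> g ` {1..k} \<subseteq> carrier G \<and>
      (\<forall>i\<in>{1..k}. \<forall>j\<in>{1..k}. f (\<phi> (g i) x) = f (\<phi> (g j) x))}"

definition A'_set ::
    "('g, 'b) monoid_scheme \<Rightarrow> 'x topology \<Rightarrow> ('g \<Rightarrow> 'x \<Rightarrow> 'x) \<Rightarrow> ('x \<Rightarrow> real) \<Rightarrow> nat \<Rightarrow> 'x set" where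
  "A'_set G X \<phi> f k = {x \<in> topspace X. \<exists>(g :: nat \<Rightarrow> 'g) (c :: real).
      inj_on g {1..k} \<and> g ` {1..k} \<subseteq> carrier G \<and>
      (\<forall>i\<in>{1..k}. f (\<phi> (g i) x) = c) \<and> (\<forall>a\<in>carrier G. f (\<phi> a x) \<le> c)}"

text \<open>With points of \<open>Euclidean_space n\<close> being the sequences supported on \<open>{..<n}\<close>, this is
  the map to \<open>Euclidean_space (Suc n)\<close> with components \<open>f\<close> and \<open>h\<close>.\<close>

definition map_oplus :: "('x \<Rightarrow> real) \<Rightarrow> ('x \<Rightarrow> nat \<Rightarrow> real) \<Rightarrow> 'x \<Rightarrow> nat \<Rightarrow> real" where
  "map_oplus f h x = (\<lambda>i. case i of 0 \<Rightarrow> f x | Suc j \<Rightarrow> h x j)"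

end

theory Submission
  imports Defs "HOL-Analysis.Abstract_Topological_Spaces"
begin

text \<open>The set \<open>Z = A'(f\<^sub>1,k) \<inter> A(h,q)\<close> has a complement that is easy to cover. Order the group
  elements by decreasing value of a real function \<open>u\<close> along the orbit of \<open>x\<close>, and let the gap
  set \<open>U\<^sub>i(u)\<close> consist of the points \<open>x\<close> at which the \<open>i\<close>-th value is strictly larger than the
  next one. The \<open>i\<close> group elements with the largest values then form a well-defined subset of
  \<open>G\<close>, which depends on \<open>x\<close> locally constantly and equivariantly. For \<open>0 < i < |G|\<close> such
  subsets are not fixed by \<open>G\<close>, so \<open>U\<^sub>i(u)\<close> is open, invariant and maps equivariantly to \<open>D\<^sub>G\<close>
  (\<open>genus_piece_gap_set\<close>).

  The maximum of \<open>u\<close> on the orbit is attained fewer than \<open>k\<close> times exactly when there is a gap at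
  some \<open>i < k\<close> (\<open>A'_set_eq_complement\<close>). Hence the complement of \<open>A'(f\<^sub>1,k)\<close> is the union of \<open>k - 1\<close>
  gap sets of \<open>f\<^sub>1\<close>. For \<open>k = |G|\<close> the same fact says that the points where a real function is not
  constant on the orbit are covered by \<open>|G| - 1\<close> gap sets; applied to the \<open>m - 1\<close> coordinates of
  \<open>h\<close>, this covers the complement of \<open>A(h,q)\<close>. Altogether \<open>X - Z\<close> is a union of at most
  \<open>(|G| - 1)(m - 1) + k - 1\<close> sets of the kind used in the definition of the genus; in particular
  \<open>Z\<close> is closed and invariant.

  The lower bound for the genus of \<open>Z\<close> follows once every cover of \<open>Z\<close> by relatively open sets of
  that kind extends to a cover by as many such sets open in \<open>X\<close> (\<open>extend_pieces\<close>): together with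
  the gap sets they cover \<open>X\<close>. The extension uses that \<open>X\<close> is normal and that disjoint
  neighbourhoods of finitely many closed sets permuted by \<open>G\<close> can be made to be permuted by \<open>G\<close>.
  The other inequality is monotonicity of the genus, since \<open>Z\<close> is contained in
  \<open>A(f\<^sub>1 \<oplus> h,k)\<close>.\<close>

section \<open>Normality of paracompact spaces\<close>

text \<open>The closures of a locally finite family have a closed union, so the closures of
  neighbourhoods of single points of \<open>S\<close> can be replaced by one closure for all of \<open>S\<close>.
  Applied once to pass from points to a point and a closed set, and once more to pass to two
  closed sets, this yields normality.\<close>

lemma paracompact_separation:
  assumes X: "paracompact_space X" and S: "closedin X S"
    and loc: "\<And>x. x \<in> S \<Longrightarrow> \<exists>U. openin X U \<and> x \<in> U \<and> disjnt T (X closure_of U)"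
  shows "\<exists>W. openin X W \<and> S \<subseteq> W \<and> disjnt T (X closure_of W)"
proof -
  obtain U where U: "\<And>x. x \<in> S \<Longrightarrow> openin X (U x) \<and> x \<in> U x \<and> disjnt T (X closure_of U x)"
    using loc by metis
  define \<U> where "\<U> = insert (topspace X - S) (U ` S)"
  have "openin X (topspace X - S)"
    using S by blast
  then have "\<forall>V\<in>\<U>. openin X V"
    using U unfolding \<U>_def by blast
  moreover have "\<Union>\<U> = topspace X"
  proof
    show "\<Union>\<U> \<subseteq> topspace X"
      using calculation openin_subset by (metis Sup_least)
    have "x \<in> \<Union>\<U>" if "x \<in> topspace X" for x
      by (cases "x \<in> S") (use that U[of x] in \<open>auto simp: \<U>_def\<close>)
    then show "topspace X \<subseteq> \<Union>\<U>"
      by blast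
  qed
  ultimately obtain \<V> where \<V>: "\<forall>V\<in>\<V>. openin X V" "\<Union>\<V> = topspace X"
      "\<forall>V\<in>\<V>. \<exists>U\<in>\<U>. V \<subseteq> U" "locally_finite_in X \<V>"
    using X[unfolded paracompact_space_def, THEN conjunct2, THEN spec, of \<U>] by blast
  define \<W> where "\<W> = {V \<in> \<V>. V \<inter> S \<noteq> {}}"
  have "locally_finite_in X \<W>"
    using \<V>(4) by (rule locally_finite_in_subset) (auto simp: \<W>_def)
  then have cl: "X closure_of \<Union>\<W> = \<Union>((closure_of) X ` \<W>)"
    by (rule closure_of_locally_finite_Union)
  have "disjnt T (X closure_of V)" if "V \<in> \<W>" for V
  proof -
    have "V \<in> \<V>" "V \<inter> S \<noteq> {}"
      using that by (auto simp: \<W>_def)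
    moreover from this(1) obtain U' where "U' \<in> \<U>" "V \<subseteq> U'"
      using \<V>(3) by blast
    ultimately obtain x where "x \<in> S" "V \<subseteq> U x"
      unfolding \<U>_def by auto
    then show ?thesis
      using U[of x] closure_of_mono[of V "U x" X] by (auto simp: disjnt_iff)
  qed
  moreover have "S \<subseteq> \<Union>\<W>"
    using \<V>(2) closedin_subset[OF S] unfolding \<W>_def by blast
  moreover have "openin X (\<Union>\<W>)"
    using \<V>(1) unfolding \<W>_def by blast
  ultimately show ?thesis
    by (intro exI[of _ "\<Union>\<W>"]) (auto simp: cl)
qed

lemma paracompact_imp_normal_space:
  assumes X: "paracompact_space X"
  shows "normal_space X"
  unfolding normal_space
proof (intro allI impI)
  have reg: "\<exists>V. openin X V \<and> y \<in> V \<and> disjnt S (X closure_of V)"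
    if S: "closedin X S" and y: "y \<in> topspace X" "y \<notin> S" for S y
  proof -
    have "\<exists>U. openin X U \<and> x \<in> U \<and> disjnt {y} (X closure_of U)" if "x \<in> S" for x
    proof -
      have "x \<in> topspace X" "x \<noteq> y"
        using that S y closedin_subset by auto
      then obtain U V where "openin X U" "openin X V" "x \<in> U" "y \<in> V" "disjnt U V"
        using X y unfolding paracompact_space_def Hausdorff_space_def by metis
      then show ?thesis
        by (intro exI[of _ U]) (auto simp: in_closure_of disjnt_iff)
    qed
    then obtain W where "openin X W" "S \<subseteq> W" "disjnt {y} (X closure_of W)"
      using paracompact_separation[OF X S, of "{y}"] by auto
    then show ?thesis
      using y closure_of_subset[OF openin_subset, of X W]
      by (intro exI[of _ "topspace X - X closure_of W"])
        (auto simp: openin_diff disjnt_iff in_closure_of)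
  qed
  fix S T assume ST: "closedin X S \<and> closedin X T \<and> disjnt S T"
  then have "\<exists>U. openin X U \<and> x \<in> U \<and> disjnt T (X closure_of U)" if "x \<in> S" for x
    using reg[of T x] that closedin_subset by (auto simp: disjnt_iff)
  then show "\<exists>U. openin X U \<and> S \<subseteq> U \<and> disjnt T (X closure_of U)"
    using paracompact_separation[OF X] ST by metis
qed

text \<open>Separating each \<open>C i\<close> from the union of the others gives \<open>P i \<supseteq> C i\<close> and
  \<open>Q i \<supseteq> (\<Union>j\<in>I-{i}. C j)\<close>; intersecting \<open>P i\<close> with all the other \<open>Q j\<close> makes the
  neighbourhoods disjoint simultaneously.\<close>

lemma normal_space_separates_finite_family:
  assumes X: "normal_space X" and fin: "finite I"
    and C: "\<And>i. i \<in> I \<Longrightarrow> closedin X (C i)" and dis: "disjoint_family_on C I"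
  obtains V where "\<And>i. i \<in> I \<Longrightarrow> openin X (V i)" and "\<And>i. i \<in> I \<Longrightarrow> C i \<subseteq> V i"
    and "disjoint_family_on V I"
proof -
  have "\<exists>P Q. openin X P \<and> openin X Q \<and> C i \<subseteq> P \<and> (\<Union>j\<in>I-{i}. C j) \<subseteq> Q \<and> disjnt P Q"
    if "i \<in> I" for i
  proof -
    have "closedin X (\<Union>j\<in>I-{i}. C j)"
      using fin C by (intro closedin_Union) auto
    moreover have "disjnt (C i) (\<Union>j\<in>I-{i}. C j)"
      using dis that by (auto simp: disjoint_family_on_def disjnt_def)
    ultimately show ?thesis
      using X C[OF that] unfolding normal_space_def by blast
  qed
  then obtain P Q where PQ: "\<And>i. i \<in> I \<Longrightarrow> openin X (P i) \<and> openin X (Q i) \<and> C i \<subseteq> P i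
      \<and> (\<Union>j\<in>I-{i}. C j) \<subseteq> Q i \<and> disjnt (P i) (Q i)"
    by metis
  define V where "V i = \<Inter>(insert (P i) (Q ` (I-{i})))" for i
  have "openin X (V i)" if "i \<in> I" for i
    using PQ that fin unfolding V_def by (intro openin_Inter) auto
  moreover have "C i \<subseteq> V i" if "i \<in> I" for i
    using PQ that unfolding V_def by blast
  moreover have "disjoint_family_on V I"
    unfolding disjoint_family_on_def
  proof (intro ballI impI)
    fix i j assume ij: "i \<in> I" "j \<in> I" "i \<noteq> j"
    then have "V i \<subseteq> P i" "V j \<subseteq> Q i"
      by (auto simp: V_def)
    then show "V i \<inter> V j = {}"
      using PQ[OF ij(1)] unfolding disjnt_def by blast
  qed
  ultimately show ?thesis by (rule that)
qed

section \<open>Pieces of a genus cover\<close>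

text \<open>An equivariant continuous map to a discrete \<open>G\<close>-set \<open>\<Omega>\<close> (with action \<open>\<psi>\<close>) is the same as
  the family of its fibres. Families of fibres are easier to restrict, to enlarge and to
  construct than maps, because nothing has to be said about points outside their union.\<close>

definition equivariant_family ::
    "('g, 'b) monoid_scheme \<Rightarrow> ('g \<Rightarrow> 'x \<Rightarrow> 'x) \<Rightarrow> 'x topology \<Rightarrow> 'w set \<Rightarrow> ('g \<Rightarrow> 'w \<Rightarrow> 'w) \<Rightarrow> ('w \<Rightarrow> 'x set) \<Rightarrow> bool" where
  "equivariant_family G \<phi> Y \<Omega> \<psi> V \<longleftrightarrow>
     (\<forall>w\<in>\<Omega>. openin Y (V w)) \<and> disjoint_family_on V \<Omega> \<and>
     (\<forall>g\<in>carrier G. \<forall>w\<in>\<Omega>. \<forall>x\<in>V w. \<phi> g x \<in> V (\<psi> g w))"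

definition genus_piece ::
    "('g, 'b) monoid_scheme \<Rightarrow> ('g \<Rightarrow> 'x \<Rightarrow> 'x) \<Rightarrow> 'x topology \<Rightarrow> 'x set \<Rightarrow> bool" where
  "genus_piece G \<phi> Y U \<longleftrightarrow>
     openin Y U \<and> (\<forall>g\<in>carrier G. \<phi> g ` U \<subseteq> U) \<and> admits_map_to_orbit_sum G \<phi> (subtopology Y U)"

text \<open>Finite sets of pieces replace the indexed covers in the definition of the genus; covers can
  then be united and restricted without reindexing.\<close>

lemma genus_le_iff:
  "genus G \<phi> Y \<le> enat n \<longleftrightarrow>
     (\<exists>\<U>. finite \<U> \<and> card \<U> \<le> n \<and> (\<forall>U\<in>\<U>. genus_piece G \<phi> Y U) \<and> \<Union>\<U> = topspace Y)"
    (is "_ \<longleftrightarrow> ?rhs")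
proof
  define A where "A = {enat n | n. \<exists>U. (\<Union>i\<in>{1..n}. U i) = topspace Y \<and>
    (\<forall>i\<in>{1..n}. genus_piece G \<phi> Y (U i))}"
  have g: "genus G \<phi> Y = Inf A"
    by (simp add: genus_def genus_piece_def A_def)
  show ?rhs if "genus G \<phi> Y \<le> enat n"
  proof -
    have "A \<noteq> {}"
      using that by (auto simp: g Inf_enat_def)
    then have "Inf A \<in> A"
      unfolding Inf_enat_def by (auto intro: LeastI)
    then obtain n' U where n': "Inf A = enat n'" and U: "(\<Union>i\<in>{1..n'}. U i) = topspace Y"
        "\<forall>i\<in>{1..n'}. genus_piece G \<phi> Y (U i)"
      unfolding A_def by auto
    have "card (U ` {1..n'}) \<le> n"
      using card_image_le[of "{1..n'}" U] that n' g by simp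
    then show ?rhs
      using U by (intro exI[of _ "U ` {1..n'}"]) auto
  qed
  show "genus G \<phi> Y \<le> enat n" if rhs: ?rhs
  proof -
    obtain \<U> where \<U>: "finite \<U>" "card \<U> \<le> n" "\<forall>U\<in>\<U>. genus_piece G \<phi> Y U" "\<Union>\<U> = topspace Y"
      using rhs by (elim exE conjE)
    obtain U where "bij_betw U {1..card \<U>} \<U>"
      using ex_bij_betw_nat_finite_1[OF \<U>(1)] by auto
    then have "U ` {1..card \<U>} = \<U>"
      by (simp add: bij_betw_def)
    then have "(\<Union>i\<in>{1..card \<U>}. U i) = topspace Y"
        "\<forall>i\<in>{1..card \<U>}. genus_piece G \<phi> Y (U i)"
      using \<U>(3,4) by auto
    then have "enat (card \<U>) \<in> A"
      unfolding A_def by (intro CollectI exI[of _ "card \<U>"] exI[of _ U] conjI refl)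
    then have "Inf A \<le> enat (card \<U>)"
      by (rule Inf_lower)
    also have "\<dots> \<le> enat n"
      using \<U> by simp
    finally show ?thesis
      by (simp add: g)
  qed
qed

lemma genus_piece_imp_family:
  assumes "genus_piece G \<phi> Y U"
  obtains V where "equivariant_family G \<phi> Y (orbit_sum G) (orbit_sum_action G) V"
    and "U = (\<Union>d\<in>orbit_sum G. V d)"
proof -
  obtain F where U: "openin Y U" "\<And>g x. g \<in> carrier G \<Longrightarrow> x \<in> U \<Longrightarrow> \<phi> g x \<in> U"
    and F: "continuous_map (subtopology Y U) (discrete_topology (orbit_sum G)) F"
      "\<And>g x. g \<in> carrier G \<Longrightarrow> x \<in> U \<Longrightarrow> F (\<phi> g x) = orbit_sum_action G g (F x)"
    using assms openin_subset unfolding genus_piece_def admits_map_to_orbit_sum_def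
    by (fastforce simp: inf_absorb2)
  have top: "topspace (subtopology Y U) = U"
    using openin_subset[OF U(1)] by auto
  have "openin Y {x \<in> U. F x \<in> {d}}" if "d \<in> orbit_sum G" for d
    using openin_continuous_map_preimage[OF F(1), of "{d}"] that U(1)
    unfolding top by (simp add: openin_open_subtopology)
  then have "equivariant_family G \<phi> Y (orbit_sum G) (orbit_sum_action G) (\<lambda>d. {x \<in> U. F x = d})"
    using U F unfolding equivariant_family_def disjoint_family_on_def by auto
  moreover have "F x \<in> orbit_sum G" if "x \<in> U" for x
    using continuous_map_funspace[OF F(1)] that unfolding top by auto
  then have "U = (\<Union>d\<in>orbit_sum G. {x \<in> U. F x = d})"
    by auto
  ultimately show ?thesis
    by (rule that)
qed

section \<open>The orbit sum and other fixed point free sets\<close>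

lemma (in group) translate_orbit_sum:
  assumes "g \<in> carrier G" and "d \<in> orbit_sum G"
  shows "orbit_sum_action G g d \<in> orbit_sum G"
proof -
  obtain H a where H: "subgroup H G" "H \<noteq> carrier G" "a \<in> carrier G" "d = (H, a <# H)"
    using assms(2) by (auto simp: orbit_sum_def LCOSETS_def)
  then have "g <# (a <# H) = (g \<otimes> a) <# H"
    using assms(1) by (simp add: lcos_m_assoc subgroup.subset)
  then show ?thesis
    using H assms(1) by (auto simp: orbit_sum_def orbit_sum_action_def LCOSETS_def)
qed

lemma (in group) orbit_sum_action_mult:
  assumes "g \<in> carrier G" "h \<in> carrier G" "d \<in> orbit_sum G"
  shows "orbit_sum_action G g (orbit_sum_action G h d) = orbit_sum_action G (g \<otimes> h) d"
proof -
  obtain H C where d: "d = (H, C)" and "C \<subseteq> carrier G"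
    using assms(3) subgroup.lcosets_carrier[OF _ is_group]
    by (fastforce simp: orbit_sum_def)
  then show ?thesis
    using assms by (simp add: orbit_sum_action_def lcos_m_assoc)
qed

lemma (in group) orbit_sum_action_one:
  assumes "d \<in> orbit_sum G"
  shows "orbit_sum_action G \<one> d = d"
  using assms subgroup.lcosets_carrier[OF _ is_group]
  by (fastforce simp: orbit_sum_action_def lcos_mult_one orbit_sum_def)

lemma (in group) finite_orbit_sum:
  assumes "finite (carrier G)"
  shows "finite (orbit_sum G)"
proof (rule finite_subset)
  show "orbit_sum G \<subseteq> Pow (carrier G) \<times> Pow (carrier G)"
    using subgroup.lcosets_carrier[OF _ is_group] subgroup.subset
    by (fastforce simp: orbit_sum_def)
qed (use assms in simp)

text \<open>Any \<open>G\<close>-set \<open>\<Omega>\<close> without fixed points maps equivariantly to \<open>D\<^sub>G\<close>: after choosing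
  a base point \<open>r\<close> in each orbit, the orbit-stabiliser correspondence sends \<open>w\<close> to the coset of
  all group elements that carry \<open>r\<close> to \<open>w\<close>. Hence labels in \<open>\<Omega>\<close> are as good as labels in
  \<open>D\<^sub>G\<close> for bounding the genus.\<close>

lemma (in group) orbit_sum_universal:
  assumes closed: "\<And>g w. g \<in> carrier G \<Longrightarrow> w \<in> \<Omega> \<Longrightarrow> \<psi> g w \<in> \<Omega>"
    and mult: "\<And>g h w. g \<in> carrier G \<Longrightarrow> h \<in> carrier G \<Longrightarrow> w \<in> \<Omega> \<Longrightarrow> \<psi> (g \<otimes> h) w = \<psi> g (\<psi> h w)"
    and one: "\<And>w. w \<in> \<Omega> \<Longrightarrow> \<psi> \<one> w = w"
    and free: "\<And>w. w \<in> \<Omega> \<Longrightarrow> \<exists>g\<in>carrier G. \<psi> g w \<noteq> w"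
  shows "\<exists>e. (\<forall>w\<in>\<Omega>. e w \<in> orbit_sum G) \<and>
    (\<forall>g\<in>carrier G. \<forall>w\<in>\<Omega>. e (\<psi> g w) = orbit_sum_action G g (e w))"
proof -
  have undo: "\<psi> (inv g) (\<psi> g w) = w" "\<psi> g (\<psi> (inv g) w) = w"
    if "g \<in> carrier G" "w \<in> \<Omega>" for g w
    using that mult[of "inv g" g w] mult[of g "inv g" w] one by auto
  define orb where "orb w = {\<psi> g w | g. g \<in> carrier G}" for w
  define r where "r w = (SOME v. v \<in> orb w)" for w
  define e where "e w = ({a \<in> carrier G. \<psi> a (r w) = r w}, {a \<in> carrier G. \<psi> a (r w) = w})" for w
  have orb: "orb (\<psi> g w) = orb w" if "g \<in> carrier G" "w \<in> \<Omega>" for g w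
  proof -
    have "\<psi> a w = \<psi> (a \<otimes> inv g) (\<psi> g w)" if "a \<in> carrier G" for a
      using that \<open>g \<in> carrier G\<close> \<open>w \<in> \<Omega>\<close> mult[of "a \<otimes> inv g" g w] by (simp add: m_assoc)
    moreover have "\<psi> a (\<psi> g w) = \<psi> (a \<otimes> g) w" if "a \<in> carrier G" for a
      using that \<open>g \<in> carrier G\<close> \<open>w \<in> \<Omega>\<close> mult by simp
    ultimately show ?thesis
      using that(1) unfolding orb_def by (safe; metis m_closed inv_closed)
  qed
  have r: "\<exists>a\<in>carrier G. \<psi> a (r w) = w" "r w \<in> \<Omega>" if "w \<in> \<Omega>" for w
  proof -
    have "w \<in> orb w"
      using one[OF that] unfolding orb_def by force
    then have "r w \<in> orb w"
      unfolding r_def by (rule someI)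
    then obtain g where "g \<in> carrier G" "r w = \<psi> g w"
      by (auto simp: orb_def)
    then show "\<exists>a\<in>carrier G. \<psi> a (r w) = w" "r w \<in> \<Omega>"
      using undo that closed inv_closed by metis+
  qed
  \<comment> \<open>Both the coset property and equivariance are instances of this translation rule.\<close>
  have tr: "g <# {a \<in> carrier G. \<psi> a v = w} = {a \<in> carrier G. \<psi> a v = \<psi> g w}"
    if g: "g \<in> carrier G" and v: "v \<in> \<Omega>" and w: "w \<in> \<Omega>" for g v w
  proof (intro equalityI subsetI)
    fix b assume "b \<in> {a \<in> carrier G. \<psi> a v = \<psi> g w}"
    then have b: "b \<in> carrier G" "\<psi> b v = \<psi> g w" by auto
    have "\<psi> (inv g \<otimes> b) v = w" "b = g \<otimes> (inv g \<otimes> b)"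
      using b g v w undo by (simp_all add: mult flip: m_assoc)
    then show "b \<in> g <# {a \<in> carrier G. \<psi> a v = w}"
      unfolding l_coset_def using b g by (intro UN_I[of "inv g \<otimes> b"]) auto
  qed (use g v mult in \<open>auto simp: l_coset_def\<close>)
  have stab: "subgroup {a \<in> carrier G. \<psi> a v = v} G" if "v \<in> \<Omega>" for v
    by (rule subgroupI) (use that one undo mult in \<open>fastforce+\<close>)
  have "e w \<in> orbit_sum G" if w: "w \<in> \<Omega>" for w
  proof -
    obtain a where a: "a \<in> carrier G" "\<psi> a (r w) = w"
      using r(1)[OF w] by auto
    have "{a \<in> carrier G. \<psi> a (r w) = w} = a <# {a \<in> carrier G. \<psi> a (r w) = r w}"
      using tr[OF a(1) r(2) r(2)] w a by simp
    moreover have "{a \<in> carrier G. \<psi> a (r w) = r w} \<noteq> carrier G"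
      using free[OF r(2)[OF w]] by auto
    ultimately show ?thesis
      using stab r(2)[OF w] a(1) by (auto simp: e_def orbit_sum_def LCOSETS_def)
  qed
  moreover have "e (\<psi> g w) = orbit_sum_action G g (e w)" if "g \<in> carrier G" "w \<in> \<Omega>" for g w
  proof -
    have "r (\<psi> g w) = r w"
      using orb[OF that] by (simp add: r_def)
    then show ?thesis
      using tr[OF that(1) r(2) that(2)] that by (simp add: e_def orbit_sum_action_def)
  qed
  ultimately show ?thesis
    by blast
qed

lemma genus_piece_of_orbit_family:
  assumes V: "equivariant_family G \<phi> Y (orbit_sum G) (orbit_sum_action G) V" and "group G"
  shows "genus_piece G \<phi> Y (\<Union>d\<in>orbit_sum G. V d)" (is "genus_piece _ _ _ ?U")
proof -
  interpret group G by fact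
  have V: "\<And>d. d \<in> orbit_sum G \<Longrightarrow> openin Y (V d)" "disjoint_family_on V (orbit_sum G)"
      "\<And>g d x. g \<in> carrier G \<Longrightarrow> d \<in> orbit_sum G \<Longrightarrow> x \<in> V d \<Longrightarrow> \<phi> g x \<in> V (orbit_sum_action G g d)"
    using V unfolding equivariant_family_def by auto
  have U: "openin Y ?U"
    using V(1) by blast
  define F where "F x = (SOME d. d \<in> orbit_sum G \<and> x \<in> V d)" for x
  have F: "F x = d" if "d \<in> orbit_sum G" "x \<in> V d" for x d
    unfolding F_def
  proof (rule some_equality)
    show "\<And>d'. d' \<in> orbit_sum G \<and> x \<in> V d' \<Longrightarrow> d' = d"
      using that V(2) unfolding disjoint_family_on_def by (metis IntI emptyE)
  qed (use that in simp)
  have top: "topspace (subtopology Y ?U) = ?U"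
    using openin_subset[OF U] by auto
  have "continuous_map (subtopology Y ?U) (discrete_topology (orbit_sum G)) F"
    unfolding continuous_map_def
  proof (intro conjI allI impI)
    show "F \<in> topspace (subtopology Y ?U) \<rightarrow> topspace (discrete_topology (orbit_sum G))"
      unfolding top using F by auto
    fix D assume "openin (discrete_topology (orbit_sum G)) D"
    then have D: "D \<subseteq> orbit_sum G" by simp
    then have "{x \<in> ?U. F x \<in> D} = (\<Union>d\<in>D. V d)"
      using F by blast
    moreover have "openin Y (\<Union>d\<in>D. V d)"
      using D V(1) by blast
    ultimately show "openin (subtopology Y ?U) {x \<in> topspace (subtopology Y ?U). F x \<in> D}"
      unfolding top openin_open_subtopology[OF U] by auto
  qed
  moreover have "F (\<phi> g x) = orbit_sum_action G g (F x)" if g: "g \<in> carrier G" and x: "x \<in> ?U" for g x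
  proof -
    obtain d where d: "d \<in> orbit_sum G" "x \<in> V d"
      using x by auto
    then show ?thesis
      using F[OF d] F[OF translate_orbit_sum V(3)] g by simp
  qed
  ultimately have "admits_map_to_orbit_sum G \<phi> (subtopology Y ?U)"
    unfolding admits_map_to_orbit_sum_def top by blast
  moreover have "\<phi> g ` ?U \<subseteq> ?U" if "g \<in> carrier G" for g
    using that V(3) translate_orbit_sum by blast
  ultimately show ?thesis
    using U by (simp add: genus_piece_def)
qed

lemma (in group) genus_piece_of_family:
  assumes V: "equivariant_family G \<phi> Y \<Omega> \<psi> V"
    and "\<And>g w. g \<in> carrier G \<Longrightarrow> w \<in> \<Omega> \<Longrightarrow> \<psi> g w \<in> \<Omega>"
    and "\<And>g h w. g \<in> carrier G \<Longrightarrow> h \<in> carrier G \<Longrightarrow> w \<in> \<Omega> \<Longrightarrow> \<psi> (g \<otimes> h) w = \<psi> g (\<psi> h w)"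
    and "\<And>w. w \<in> \<Omega> \<Longrightarrow> \<psi> \<one> w = w"
    and "\<And>w. w \<in> \<Omega> \<Longrightarrow> \<exists>g\<in>carrier G. \<psi> g w \<noteq> w"
  shows "genus_piece G \<phi> Y (\<Union>w\<in>\<Omega>. V w)"
proof -
  have "\<exists>e. (\<forall>w\<in>\<Omega>. e w \<in> orbit_sum G) \<and>
      (\<forall>g\<in>carrier G. \<forall>w\<in>\<Omega>. e (\<psi> g w) = orbit_sum_action G g (e w))"
    by (rule orbit_sum_universal) (use assms(2-5) in blast)+
  then obtain e where e: "\<forall>w\<in>\<Omega>. e w \<in> orbit_sum G"
      "\<forall>g\<in>carrier G. \<forall>w\<in>\<Omega>. e (\<psi> g w) = orbit_sum_action G g (e w)"
    by (elim exE conjE)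
  define W where "W d = (\<Union>w\<in>{w \<in> \<Omega>. e w = d}. V w)" for d
  have "equivariant_family G \<phi> Y (orbit_sum G) (orbit_sum_action G) W"
    unfolding equivariant_family_def
  proof (intro conjI ballI)
    show "openin Y (W d)" for d
      using V unfolding W_def equivariant_family_def by (intro openin_Union) auto
    show "disjoint_family_on W (orbit_sum G)"
      using V by (fastforce simp: W_def equivariant_family_def disjoint_family_on_def)
    show "\<phi> g x \<in> W (orbit_sum_action G g d)" if g: "g \<in> carrier G" and x: "x \<in> W d" for g d x
    proof -
      obtain w where w: "w \<in> \<Omega>" "e w = d" "x \<in> V w"
        using x by (auto simp: W_def)
      then have "\<phi> g x \<in> V (\<psi> g w)" "\<psi> g w \<in> \<Omega>" "e (\<psi> g w) = orbit_sum_action G g d"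
        using V g e(2) assms(2) by (auto simp: equivariant_family_def)
      then show ?thesis
        by (auto simp: W_def)
    qed
  qed
  moreover have "(\<Union>w\<in>\<Omega>. V w) = (\<Union>d\<in>orbit_sum G. W d)"
    using e(1) by (auto simp: W_def)
  ultimately show ?thesis
    using genus_piece_of_orbit_family is_group by metis
qed

section \<open>Enlarging covers of closed invariant subsets\<close>

locale finite_G_space = group G for G (structure) +
  fixes X :: "'x topology" and \<phi> :: "'a \<Rightarrow> 'x \<Rightarrow> 'x"
  assumes finite_carrier: "finite (carrier G)" and G_space: "G_space G X \<phi>"
begin

sublocale act: group_action G "topspace X" \<phi>
  using G_space by (simp add: G_space_def)

lemma act_in: "g \<in> carrier G \<Longrightarrow> x \<in> topspace X \<Longrightarrow> \<phi> g x \<in> topspace X"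
  using act.element_image by blast

lemma act_one: "x \<in> topspace X \<Longrightarrow> \<phi> \<one> x = x"
  using act.id_eq_one by (metis restrict_apply')

lemma act_mult:
  "g \<in> carrier G \<Longrightarrow> h \<in> carrier G \<Longrightarrow> x \<in> topspace X \<Longrightarrow> \<phi> g (\<phi> h x) = \<phi> (g \<otimes> h) x"
  using act.composition_rule by simp

lemma continuous_act: "g \<in> carrier G \<Longrightarrow> continuous_map X X (\<phi> g)"
  using G_space by (simp add: G_space_def)

definition invariant :: "'x set \<Rightarrow> bool" where
  "invariant S \<longleftrightarrow> (\<forall>g\<in>carrier G. \<forall>x\<in>S. \<phi> g x \<in> S)"

lemma invariant_Diff:
  assumes "invariant S" "invariant T" "S \<subseteq> topspace X"
  shows "invariant (S - T)"
  unfolding invariant_def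
proof (intro ballI DiffI)
  fix g x assume g: "g \<in> carrier G" and x: "x \<in> S - T"
  show "\<phi> g x \<in> S"
    using assms g x by (auto simp: invariant_def)
  show "\<phi> g x \<notin> T"
  proof
    assume "\<phi> g x \<in> T"
    then have "\<phi> (inv g) (\<phi> g x) \<in> T"
      using assms g by (auto simp: invariant_def)
    moreover have "\<phi> (inv g) (\<phi> g x) = x"
      using g x assms(3) by (subst act_mult) (auto simp: act_one)
    ultimately show False
      using x by simp
  qed
qed

lemma invariant_Union: "(\<And>U. U \<in> \<U> \<Longrightarrow> invariant U) \<Longrightarrow> invariant (\<Union>\<U>)"
  by (auto simp: invariant_def)

lemma genus_piece_invariant: "genus_piece G \<phi> Y U \<Longrightarrow> invariant U"
  by (auto simp: genus_piece_def invariant_def)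

lemma genus_piece_restrict:
  assumes U: "genus_piece G \<phi> (subtopology X B) U" and Z: "Z \<subseteq> B" "invariant Z"
  shows "genus_piece G \<phi> (subtopology X Z) (U \<inter> Z)"
proof -
  obtain V where V: "equivariant_family G \<phi> (subtopology X B) (orbit_sum G) (orbit_sum_action G) V"
    and UV: "U = (\<Union>d\<in>orbit_sum G. V d)"
    using genus_piece_imp_family[OF U] by blast
  have "openin (subtopology X Z) (V d \<inter> Z)" if "d \<in> orbit_sum G" for d
  proof -
    have "openin (subtopology (subtopology X B) Z) (Z \<inter> V d)"
      using V that by (intro openin_subtopology_Int2) (simp add: equivariant_family_def)
    then show ?thesis
      using Z(1) by (simp add: subtopology_subtopology inf_absorb2 Int_commute)
  qed
  then have "equivariant_family G \<phi> (subtopology X Z) (orbit_sum G) (orbit_sum_action G) (\<lambda>d. V d \<inter> Z)"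
    using V Z(2) unfolding equivariant_family_def disjoint_family_on_def invariant_def
    by (intro conjI ballI impI; simp; blast)
  then have "genus_piece G \<phi> (subtopology X Z) (\<Union>d\<in>orbit_sum G. V d \<inter> Z)"
    by (rule genus_piece_of_orbit_family) (rule is_group)
  moreover have "(\<Union>d\<in>orbit_sum G. V d \<inter> Z) = U \<inter> Z"
    using UV by auto
  ultimately show ?thesis
    by simp
qed

lemma genus_mono:
  assumes "Z \<subseteq> B" "invariant Z"
  shows "genus G \<phi> (subtopology X Z) \<le> genus G \<phi> (subtopology X B)"
proof (cases "genus G \<phi> (subtopology X B)")
  case (enat n)
  then obtain \<U> where \<U>: "finite \<U>" "card \<U> \<le> n" "\<forall>U\<in>\<U>. genus_piece G \<phi> (subtopology X B) U"
      "\<Union>\<U> = topspace X \<inter> B"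
    using genus_le_iff[of G \<phi> "subtopology X B" n] by auto
  have "card ((\<lambda>U. U \<inter> Z) ` \<U>) \<le> n"
    using card_image_le[OF \<U>(1), of "\<lambda>U. U \<inter> Z"] \<U>(2) by linarith
  moreover have "\<Union>((\<lambda>U. U \<inter> Z) ` \<U>) = topspace (subtopology X Z)"
    using \<U>(4) assms(1) by auto
  ultimately have "genus G \<phi> (subtopology X Z) \<le> enat n"
    using \<U> genus_piece_restrict[OF _ assms]
    by (intro genus_le_iff[THEN iffD2] exI[of _ "(\<lambda>U. U \<inter> Z) ` \<U>"]) auto
  then show ?thesis
    using enat by simp
qed simp

text \<open>The fibres of the map to \<open>D\<^sub>G\<close> cut \<open>F\<close> into finitely many disjoint closed sets, which
  normality separates by open sets \<open>P d\<close>. These need not be permuted by the action; the sets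
  \<open>Q d\<close> of points all of whose translates \<open>\<phi> g x\<close> lie in \<open>P (g d)\<close> are open because \<open>G\<close> is
  finite, are permuted, and still contain the parts of \<open>F\<close>.\<close>

lemma closed_subset_of_piece_has_piece_nbhd:
  assumes X: "normal_space X" and F: "closedin X F" "invariant F" "F \<subseteq> U"
    and U: "genus_piece G \<phi> (subtopology X Z) U" and Z: "closedin X Z"
  obtains W where "genus_piece G \<phi> X W" and "F \<subseteq> W"
proof -
  let ?D = "orbit_sum G" and ?\<psi> = "orbit_sum_action G"
  obtain V where V: "equivariant_family G \<phi> (subtopology X Z) ?D ?\<psi> V" and UV: "U = (\<Union>d\<in>?D. V d)"
    using genus_piece_imp_family[OF U] by blast
  have V': "disjoint_family_on V ?D" "\<And>d. d \<in> ?D \<Longrightarrow> openin (subtopology X Z) (V d)"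
      "\<And>g d x. g \<in> carrier G \<Longrightarrow> d \<in> ?D \<Longrightarrow> x \<in> V d \<Longrightarrow> \<phi> g x \<in> V (?\<psi> g d)"
    using V by (auto simp: equivariant_family_def)
  have "U \<subseteq> Z"
    using U openin_subset[of "subtopology X Z" U] by (simp add: genus_piece_def)
  then have FZ: "closedin (subtopology X Z) F"
    using F by (simp add: closedin_closed_subtopology[OF Z])
  have closed: "closedin X (F \<inter> V d)" if "d \<in> ?D" for d
  proof -
    have "F \<inter> V d = F - (\<Union>d'\<in>?D-{d}. V d')"
      using that F(3) UV V'(1) unfolding disjoint_family_on_def by blast
    moreover have "closedin (subtopology X Z) (F - (\<Union>d'\<in>?D-{d}. V d'))"
      using V'(2) by (intro closedin_diff[OF FZ]) blast
    ultimately show ?thesis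
      using closedin_closed_subtopology[OF Z] by simp
  qed
  have "disjoint_family_on (\<lambda>d. F \<inter> V d) ?D"
    using V'(1) unfolding disjoint_family_on_def by blast
  with X finite_orbit_sum[OF finite_carrier] closed
  obtain P where P: "\<And>d. d \<in> ?D \<Longrightarrow> openin X (P d)" "\<And>d. d \<in> ?D \<Longrightarrow> F \<inter> V d \<subseteq> P d"
      and Pdis: "disjoint_family_on P ?D"
    by (rule normal_space_separates_finite_family) (assumption | (rule that; blast))+
  define Q where "Q d = (\<Inter>g\<in>carrier G. {x \<in> topspace X. \<phi> g x \<in> P (?\<psi> g d)})" for d
  have "openin X (Q d)" if "d \<in> ?D" for d
    unfolding Q_def
  proof (intro openin_INT2 openin_continuous_map_preimage)
    show "openin X (P (?\<psi> g d))" if "g \<in> carrier G" for g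
      using translate_orbit_sum[OF that \<open>d \<in> ?D\<close>] by (rule P(1))
  qed (use finite_carrier continuous_act in auto)
  moreover have "Q d \<subseteq> P d" if "d \<in> ?D" for d
  proof
    fix x assume "x \<in> Q d"
    then have "x \<in> topspace X" "\<phi> \<one> x \<in> P (?\<psi> \<one> d)"
      using one_closed by (auto simp: Q_def)
    then show "x \<in> P d"
      by (simp add: act_one orbit_sum_action_one[OF that])
  qed
  then have "disjoint_family_on Q ?D"
    by (intro disjoint_family_on_bisimulation[OF Pdis]) blast
  moreover have "\<phi> h x \<in> Q (?\<psi> h d)" if "h \<in> carrier G" "d \<in> ?D" "x \<in> Q d" for h d x
    using that act_in act_mult orbit_sum_action_mult by (auto simp: Q_def)
  ultimately have "equivariant_family G \<phi> X ?D ?\<psi> Q"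
    by (simp add: equivariant_family_def)
  then have "genus_piece G \<phi> X (\<Union>d\<in>?D. Q d)"
    by (rule genus_piece_of_orbit_family) (rule is_group)
  moreover have "F \<inter> V d \<subseteq> Q d" if "d \<in> ?D" for d
  proof -
    have "\<phi> g x \<in> P (?\<psi> g d)" if "g \<in> carrier G" "x \<in> F \<inter> V d" for g x
    proof -
      have "\<phi> g x \<in> F \<inter> V (?\<psi> g d)"
        using that \<open>d \<in> ?D\<close> F(2) V'(3) by (simp add: invariant_def)
      then show ?thesis
        using P translate_orbit_sum[OF that(1) \<open>d \<in> ?D\<close>] by blast
    qed
    then show ?thesis
      using closedin_subset[OF F(1)] by (auto simp: Q_def)
  qed
  then have "F \<subseteq> (\<Union>d\<in>?D. Q d)"
    using F(3) UV by blast
  ultimately show ?thesis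
    by (rule that)
qed

text \<open>A closed invariant set covered by relatively open pieces is covered by no more pieces that are
  open in \<open>X\<close>. The part of \<open>S\<close> missed by all pieces but \<open>U\<close> is closed, so it has a
  neighbourhood \<open>W\<close> that is a piece of \<open>X\<close>; the remaining pieces cover the closed set \<open>S - W\<close>.\<close>

lemma extend_pieces:
  assumes X: "normal_space X" and Z: "closedin X Z"
    and "finite \<U>" and "closedin X S" and "invariant S" and "S \<subseteq> \<Union>\<U>"
    and "\<And>U. U \<in> \<U> \<Longrightarrow> genus_piece G \<phi> (subtopology X Z) U"
  shows "\<exists>\<V>. finite \<V> \<and> card \<V> \<le> card \<U> \<and> (\<forall>V\<in>\<V>. genus_piece G \<phi> X V) \<and> S \<subseteq> \<Union>\<V>"
  using assms(3-7)
proof (induction \<U> arbitrary: S rule: finite_induct)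
  case empty
  then show ?case
    by (intro exI[of _ "{}"]) auto
next
  case (insert U \<U>)
  have "V \<subseteq> Z" if "V \<in> insert U \<U>" for V
    using openin_subset[of "subtopology X Z" V] insert.prems(4)[OF that]
    by (simp add: genus_piece_def)
  then have SZ: "S \<subseteq> Z"
    using insert.prems(3) by blast
  define F where "F = S - \<Union>\<U>"
  have "openin (subtopology X Z) (\<Union>\<U>)"
    using insert.prems(4) by (auto simp: genus_piece_def)
  moreover have "closedin (subtopology X Z) S"
    using insert.prems(1) SZ by (simp add: closedin_closed_subtopology[OF Z])
  ultimately have "closedin (subtopology X Z) F"
    unfolding F_def by (intro closedin_diff)
  then have "closedin X F"
    using closedin_closed_subtopology[OF Z] by simp
  moreover have "invariant F"
    unfolding F_def
  proof (intro invariant_Diff invariant_Union)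
    show "invariant V" if "V \<in> \<U>" for V
      using genus_piece_invariant[OF insert.prems(4)] that by simp
  qed (use insert.prems(1,2) closedin_subset in auto)
  moreover have "F \<subseteq> U"
    using insert.prems(3) by (auto simp: F_def)
  ultimately obtain W where W: "genus_piece G \<phi> X W" "F \<subseteq> W"
    using closed_subset_of_piece_has_piece_nbhd[OF X _ _ _ _ Z] insert.prems(4) by blast
  have "closedin X (S - W)"
    using W insert.prems(1) by (intro closedin_diff) (auto simp: genus_piece_def)
  moreover have "invariant (S - W)"
    using insert.prems(1,2) W closedin_subset genus_piece_invariant by (intro invariant_Diff) auto
  moreover have "S - W \<subseteq> \<Union>\<U>"
    using W by (auto simp: F_def)
  ultimately obtain \<V> where \<V>: "finite \<V>" "card \<V> \<le> card \<U>" "\<forall>V\<in>\<V>. genus_piece G \<phi> X V" "S - W \<subseteq> \<Union>\<V>"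
    using insert.IH[of "S - W"] insert.prems(4) by auto
  have "card (insert W \<V>) \<le> card (insert U \<U>)"
    using insert.hyps \<V> card_insert_le_m1[of "card (insert U \<U>)" \<V> W] by simp
  then show ?case
    using \<V> W by (intro exI[of _ "insert W \<V>"]) auto
qed

lemma genus_le_closed_plus_cover_of_complement:
  assumes X: "normal_space X" and Z: "closedin X Z" "invariant Z"
    and \<W>: "finite \<W>" "\<And>W. W \<in> \<W> \<Longrightarrow> genus_piece G \<phi> X W" "topspace X - Z \<subseteq> \<Union>\<W>"
  shows "genus G \<phi> X \<le> genus G \<phi> (subtopology X Z) + enat (card \<W>)"
proof (cases "genus G \<phi> (subtopology X Z)")
  case (enat n)
  then obtain \<U> where \<U>: "finite \<U>" "card \<U> \<le> n" "\<forall>U\<in>\<U>. genus_piece G \<phi> (subtopology X Z) U"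
      "\<Union>\<U> = topspace (subtopology X Z)"
    using genus_le_iff[of G \<phi> "subtopology X Z" n] by auto
  then obtain \<V> where \<V>: "finite \<V>" "card \<V> \<le> n" "\<forall>V\<in>\<V>. genus_piece G \<phi> X V" "Z \<subseteq> \<Union>\<V>"
    using extend_pieces[OF X Z(1) \<U>(1) Z] closedin_subset[OF Z(1)] by (auto intro: order_trans)
  have "card (\<V> \<union> \<W>) \<le> n + card \<W>"
    using card_Un_le[of \<V> \<W>] \<V>(2) by linarith
  moreover have "\<Union>(\<V> \<union> \<W>) = topspace X"
  proof
    show "\<Union>(\<V> \<union> \<W>) \<subseteq> topspace X"
    proof (rule Union_least)
      fix U assume "U \<in> \<V> \<union> \<W>"
      then show "U \<subseteq> topspace X"
        using \<V>(3) \<W>(2)[of U] openin_subset[of X U] by (auto simp: genus_piece_def)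
    qed
    show "topspace X \<subseteq> \<Union>(\<V> \<union> \<W>)"
      using \<V>(4) \<W>(3) by auto
  qed
  ultimately have "genus G \<phi> X \<le> enat (n + card \<W>)"
    using \<V> \<W> by (intro genus_le_iff[THEN iffD2] exI[of _ "\<V> \<union> \<W>"]) auto
  then show ?thesis
    using enat by simp
qed simp

section \<open>Gaps in the values of a function along orbits\<close>

text \<open>The points at which \<open>T\<close> is an initial segment of \<open>G\<close> when the group elements are ordered by
  decreasing value of \<open>u\<close> on the orbit, with a strict drop of the values after \<open>T\<close>.\<close>

definition gap_cell :: "('x \<Rightarrow> real) \<Rightarrow> 'a set \<Rightarrow> 'x set" where
  "gap_cell u T = {x \<in> topspace X. \<forall>a\<in>T. \<forall>b\<in>carrier G - T. u (\<phi> b x) < u (\<phi> a x)}"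

definition gap_set :: "('x \<Rightarrow> real) \<Rightarrow> nat \<Rightarrow> 'x set" where
  "gap_set u i = (\<Union>T\<in>{T. T \<subseteq> carrier G \<and> card T = i}. gap_cell u T)"

text \<open>At a given point at most one set \<open>T\<close> of cardinality \<open>i\<close> can have all its values above the
  rest, and moving the point by \<open>g\<close> replaces \<open>T\<close> by \<open>T \<cdot> inv g\<close>. So \<open>T\<close> is a locally constant
  equivariant label in the \<open>i\<close>-element subsets of \<open>G\<close>, which has no fixed points since a
  nonempty proper subset of \<open>G\<close> is not invariant under right translations.\<close>

lemma genus_piece_gap_set:
  assumes u: "continuous_map X euclideanreal u" and i: "1 \<le> i" "i < order G"
  shows "genus_piece G \<phi> X (gap_set u i)"
  unfolding gap_set_def
proof (rule genus_piece_of_family)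
  let ?\<Omega> = "{T. T \<subseteq> carrier G \<and> card T = i}" and ?\<psi> = "\<lambda>g T. {a \<in> carrier G. a \<otimes> g \<in> T}"
  show "equivariant_family G \<phi> X ?\<Omega> ?\<psi> (gap_cell u)"
    unfolding equivariant_family_def
  proof (intro conjI ballI)
    fix T assume T: "T \<in> ?\<Omega>"
    have "openin X {x \<in> topspace X. u (\<phi> b x) < u (\<phi> a x)}"
      if "a \<in> carrier G" "b \<in> carrier G" for a b
    proof -
      have "continuous_map X euclideanreal (\<lambda>x. u (\<phi> a x) - u (\<phi> b x))"
        using that continuous_map_compose[OF continuous_act u]
        by (intro continuous_map_diff) (auto simp: o_def)
      then show ?thesis
        using openin_continuous_map_preimage[of X euclideanreal _ "{0<..}"] by fastforce
    qed
    then have "openin X (topspace X \<inter> (\<Inter>p\<in>T \<times> (carrier G - T).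
        {x \<in> topspace X. u (\<phi> (snd p) x) < u (\<phi> (fst p) x)}))"
      using T finite_carrier by (intro openin_Int_Inter) (auto intro: finite_subset)
    moreover have "gap_cell u T = topspace X \<inter> (\<Inter>p\<in>T \<times> (carrier G - T).
        {x \<in> topspace X. u (\<phi> (snd p) x) < u (\<phi> (fst p) x)})"
      by (auto simp: gap_cell_def)
    ultimately show "openin X (gap_cell u T)"
      by simp
  next
    show "disjoint_family_on (gap_cell u) ?\<Omega>"
      unfolding disjoint_family_on_def
    proof (intro ballI impI)
      fix S T assume ST: "S \<in> ?\<Omega>" "T \<in> ?\<Omega>" "S \<noteq> T"
      then have "finite S" "finite T"
        using finite_carrier by (auto intro: finite_subset)
      then obtain a b where "a \<in> S - T" "b \<in> T - S"
        using ST card_subset_eq[of T S] card_subset_eq[of S T] by auto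
      then have "u (\<phi> b x) < u (\<phi> a x)" if "x \<in> gap_cell u S" for x
        using ST that by (auto simp: gap_cell_def)
      moreover have "u (\<phi> a x) < u (\<phi> b x)" if "x \<in> gap_cell u T" for x
        using ST that \<open>a \<in> S - T\<close> \<open>b \<in> T - S\<close> by (auto simp: gap_cell_def)
      ultimately show "gap_cell u S \<inter> gap_cell u T = {}"
        using less_asym by blast
    qed
  next
    fix g T x assume "g \<in> carrier G" "T \<in> ?\<Omega>" "x \<in> gap_cell u T"
    then show "\<phi> g x \<in> gap_cell u (?\<psi> g T)"
      by (auto simp: gap_cell_def act_in act_mult)
  qed
  show "?\<psi> g T \<in> ?\<Omega>" if g: "g \<in> carrier G" and T: "T \<in> ?\<Omega>" for g T
  proof -
    have "bij_betw (\<lambda>a. a \<otimes> g) (?\<psi> g T) T"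
    proof (rule bij_betw_byWitness[where f' = "\<lambda>t. t \<otimes> inv g"])
      show "(\<lambda>t. t \<otimes> inv g) ` T \<subseteq> ?\<psi> g T"
        using g T by (auto simp: m_assoc subset_iff)
    qed (use g T in \<open>auto simp: m_assoc subset_iff\<close>)
    then show ?thesis
      using T bij_betw_same_card by auto
  qed
  show "?\<psi> (g \<otimes> h) T = ?\<psi> g (?\<psi> h T)" if "g \<in> carrier G" "h \<in> carrier G" for g h T
    using that by (auto simp: m_assoc)
  show "?\<psi> \<one> T = T" if "T \<in> ?\<Omega>" for T
    using that by auto
  show "\<exists>g\<in>carrier G. ?\<psi> g T \<noteq> T" if T: "T \<in> ?\<Omega>" for T
  proof -
    obtain a where a: "a \<in> T" "a \<in> carrier G"
      using T i by (metis (mono_tags, lifting) card.empty ex_in_conv mem_Collect_eq not_one_le_zero subsetD)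
    obtain b where b: "b \<in> carrier G" "b \<notin> T"
    proof -
      have "T \<noteq> carrier G"
        using T i by (auto simp: order_def)
      then show ?thesis
        using T that by blast
    qed
    have "b \<in> ?\<psi> (inv b \<otimes> a) T"
      using a b by (simp flip: m_assoc)
    then show ?thesis
      using a b by (intro bexI[of _ "inv b \<otimes> a"]) auto
  qed
qed

text \<open>The group elements attaining the maximum of \<open>u\<close> on the orbit form an initial segment
  followed by a strict drop, and every nonempty initial segment followed by a strict drop contains
  all of them. So a gap before position \<open>k\<close> exists iff fewer than \<open>k\<close> elements attain the maximum.\<close>

lemma A'_set_eq_complement:
  assumes k: "1 \<le> k"
  shows "A'_set G X \<phi> u k = topspace X - (\<Union>i\<in>{1..<k}. gap_set u i)"
proof (intro equalityI subsetI)
  fix x assume "x \<in> A'_set G X \<phi> u k"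
  then obtain g c where x: "x \<in> topspace X" and g: "inj_on g {1..k}" "g ` {1..k} \<subseteq> carrier G"
      "\<forall>i\<in>{1..k}. u (\<phi> (g i) x) = c" "\<forall>a\<in>carrier G. u (\<phi> a x) \<le> c"
    unfolding A'_set_def by blast
  have "x \<notin> gap_cell u T" if T: "T \<subseteq> carrier G" "1 \<le> card T" "card T < k" for T
  proof
    assume xT: "x \<in> gap_cell u T"
    have "finite T"
      using T finite_carrier finite_subset by auto
    then have "\<not> g ` {1..k} \<subseteq> T"
      using card_mono[of T "g ` {1..k}"] T card_image[OF g(1)] by auto
    then obtain j where "j \<in> {1..k}" "g j \<notin> T"
      by blast
    moreover obtain a where "a \<in> T"
      using T by fastforce
    ultimately have "c < u (\<phi> a x)"
      using xT g unfolding gap_cell_def by fastforce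
    then show False
      using g(4) \<open>a \<in> T\<close> T by force
  qed
  then show "x \<in> topspace X - (\<Union>i\<in>{1..<k}. gap_set u i)"
    using x by (auto simp: gap_set_def)
next
  fix x assume x: "x \<in> topspace X - (\<Union>i\<in>{1..<k}. gap_set u i)"
  define c where "c = Max ((\<lambda>a. u (\<phi> a x)) ` carrier G)"
  define T where "T = {a \<in> carrier G. u (\<phi> a x) = c}"
  have le: "u (\<phi> a x) \<le> c" if "a \<in> carrier G" for a
    using that finite_carrier by (simp add: c_def)
  have finT: "finite T"
    using finite_carrier by (simp add: T_def)
  have "c \<in> (\<lambda>a. u (\<phi> a x)) ` carrier G"
    unfolding c_def using finite_carrier one_closed by (intro Max_in) auto
  then have "T \<noteq> {}"
    by (auto simp: T_def)
  then have "1 \<le> card T"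
    using finT by (simp add: Suc_le_eq card_gt_0_iff)
  moreover have "x \<in> gap_cell u T"
    using x le unfolding gap_cell_def T_def by (auto simp: less_le)
  ultimately have "k \<le> card T"
    using x by (auto simp: gap_set_def T_def not_less[symmetric])
  moreover obtain g where g: "bij_betw g {1..card T} T"
    using ex_bij_betw_nat_finite_1[OF finT] by auto
  ultimately have "inj_on g {1..k}" "g ` {1..k} \<subseteq> T"
    unfolding bij_betw_def by (auto intro: inj_on_subset)
  then show "x \<in> A'_set G X \<phi> u k"
    using x le unfolding A'_set_def
    by (intro CollectI conjI exI[of _ g] exI[of _ c]) (auto simp: T_def)
qed

lemma A_set_order_iff:
  "x \<in> A_set G X \<phi> f (order G) \<longleftrightarrow>
     x \<in> topspace X \<and> (\<forall>a\<in>carrier G. \<forall>b\<in>carrier G. f (\<phi> a x) = f (\<phi> b x))"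
proof
  assume "x \<in> A_set G X \<phi> f (order G)"
  then obtain g where g: "x \<in> topspace X" "inj_on g {1..order G}" "g ` {1..order G} \<subseteq> carrier G"
      "\<forall>i\<in>{1..order G}. \<forall>j\<in>{1..order G}. f (\<phi> (g i) x) = f (\<phi> (g j) x)"
    unfolding A_set_def by blast
  then have "g ` {1..order G} = carrier G"
    by (intro card_subset_eq finite_carrier) (simp_all add: card_image order_def)
  then show "x \<in> topspace X \<and> (\<forall>a\<in>carrier G. \<forall>b\<in>carrier G. f (\<phi> a x) = f (\<phi> b x))"
    using g by (metis imageE)
next
  assume x: "x \<in> topspace X \<and> (\<forall>a\<in>carrier G. \<forall>b\<in>carrier G. f (\<phi> a x) = f (\<phi> b x))"
  obtain g where "bij_betw g {1..order G} (carrier G)"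
    using ex_bij_betw_nat_finite_1[OF finite_carrier] by (auto simp: order_def)
  then have "inj_on g {1..order G}" "g ` {1..order G} = carrier G"
    by (auto simp: bij_betw_def)
  then show "x \<in> A_set G X \<phi> f (order G)"
    using x unfolding A_set_def by blast
qed

text \<open>If every group element attains the maximum then the function is constant on the orbit, which
  lets the coordinates of \<open>h\<close> be treated by the same gap sets as \<open>f\<^sub>1\<close>.\<close>

lemma A'_set_order_eq: "A'_set G X \<phi> u (order G) = A_set G X \<phi> u (order G)"
proof (intro equalityI subsetI)
  fix x assume "x \<in> A_set G X \<phi> u (order G)"
  then have x: "x \<in> topspace X" and eq: "u (\<phi> a x) = u (\<phi> \<one> x)" if "a \<in> carrier G" for a
    using that one_closed unfolding A_set_order_iff by blast+
  obtain g where g: "bij_betw g {1..order G} (carrier G)"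
    using ex_bij_betw_nat_finite_1[OF finite_carrier] by (auto simp: order_def)
  then have "\<forall>i\<in>{1..order G}. u (\<phi> (g i) x) = u (\<phi> \<one> x)"
    using eq bij_betwE by blast
  moreover have "\<forall>a\<in>carrier G. u (\<phi> a x) \<le> u (\<phi> \<one> x)"
    using eq by (metis order_refl)
  ultimately show "x \<in> A'_set G X \<phi> u (order G)"
    using x[OF one_closed] g unfolding A'_set_def bij_betw_def by blast
next
  fix x assume "x \<in> A'_set G X \<phi> u (order G)"
  then show "x \<in> A_set G X \<phi> u (order G)"
    unfolding A'_set_def A_set_def by (elim CollectE exE conjE) (intro CollectI conjI exI, auto)
qed

text \<open>Being constant on an orbit can be tested coordinatewise. This is special to \<open>k = order G\<close>: for
  smaller \<open>k\<close> the coordinates could coincide on different tuples of group elements.\<close>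

lemma A_set_order_coordinates:
  assumes "h \<in> topspace X \<rightarrow> topspace (Euclidean_space n)"
  shows "A_set G X \<phi> h (order G) = topspace X \<inter> (\<Inter>j<n. A_set G X \<phi> (\<lambda>x. h x j) (order G))"
proof -
  have "h y j = 0" if "y \<in> topspace X" "j \<ge> n" for y j
    using assms that by (auto simp: topspace_Euclidean_space Pi_iff)
  then have "h y = h z \<longleftrightarrow> (\<forall>j<n. h y j = h z j)" if "y \<in> topspace X" "z \<in> topspace X" for y z
    using that by (metis ext not_le)
  then have "h (\<phi> a x) = h (\<phi> b x) \<longleftrightarrow> (\<forall>j<n. h (\<phi> a x) j = h (\<phi> b x) j)"
    if "x \<in> topspace X" "a \<in> carrier G" "b \<in> carrier G" for x a b
    using that act_in by blast
  then have "(\<forall>a\<in>carrier G. \<forall>b\<in>carrier G. h (\<phi> a x) = h (\<phi> b x)) \<longleftrightarrow>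
      (\<forall>j<n. \<forall>a\<in>carrier G. \<forall>b\<in>carrier G. h (\<phi> a x) j = h (\<phi> b x) j)"
    if "x \<in> topspace X" for x
    using that by simp blast
  then show ?thesis
    unfolding set_eq_iff Int_iff INT_iff A_set_order_iff lessThan_iff by blast
qed

end

section \<open>The genus of the coincidence sets\<close>

theorem theorem1p8:
  fixes G :: "('g, 'b) monoid_scheme"
    and X :: "'x topology"
    and \<phi> :: "'g \<Rightarrow> 'x \<Rightarrow> 'x"
    and f\<^sub>1 :: "'x \<Rightarrow> real"
    and h :: "'x \<Rightarrow> nat \<Rightarrow> real"
    and m k q :: nat
  assumes "group G" and "finite (carrier G)" and "q = order G"
    and "1 \<le> m" and "2 \<le> k" and "k \<le> order G"
    and "paracompact_space X" and "G_space G X \<phi>" and "fixed_point_free G X \<phi>"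
    and "genus G \<phi> X > enat ((order G - 1) * (m - 1) + k - 1)"
    and "continuous_map X euclideanreal f\<^sub>1"
    and "continuous_map X (Euclidean_space (m - 1)) h"
  shows "genus G \<phi> (subtopology X (A_set G X \<phi> (map_oplus f\<^sub>1 h) k))
           \<ge> genus G \<phi> (subtopology X (A'_set G X \<phi> f\<^sub>1 k \<inter> A_set G X \<phi> h q)) \<and>
         genus G \<phi> (subtopology X (A'_set G X \<phi> f\<^sub>1 k \<inter> A_set G X \<phi> h q))
           \<ge> genus G \<phi> X - enat ((order G - 1) * (m - 1)) - enat k + 1"
proof -
  interpret finite_G_space G X \<phi>
    using assms by (simp add: finite_G_space_def finite_G_space_axioms_def)
  define Z where "Z = A'_set G X \<phi> f\<^sub>1 k \<inter> A_set G X \<phi> h q"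
  define \<W>\<^sub>f where "\<W>\<^sub>f = gap_set f\<^sub>1 ` {1..<k}"
  define \<W>\<^sub>h where "\<W>\<^sub>h = (\<lambda>(j, i). gap_set (\<lambda>x. h x j) i) ` ({..<m - 1} \<times> {1..<order G})"
  have h: "h \<in> topspace X \<rightarrow> topspace (Euclidean_space (m - 1))"
      "continuous_map X euclideanreal (\<lambda>x. h x j)" for j
  proof -
    have "continuous_map X (powertop_real UNIV) h"
      using assms(12) unfolding Euclidean_space_def by (rule continuous_map_into_fulltopology)
    then show "continuous_map X euclideanreal (\<lambda>x. h x j)"
      by (simp add: continuous_map_componentwise_UNIV)
  qed (use assms(12) continuous_map_funspace in blast)
  have A'f: "A'_set G X \<phi> f\<^sub>1 k = topspace X - \<Union>\<W>\<^sub>f"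
    using A'_set_eq_complement[of k f\<^sub>1] assms(5) by (simp add: \<W>\<^sub>f_def)
  have "1 \<le> order G"
    using assms(5,6) by simp
  then have "A_set G X \<phi> (\<lambda>x. h x j) (order G) = topspace X - (\<Union>i\<in>{1..<order G}. gap_set (\<lambda>x. h x j) i)" for j
    by (simp only: A'_set_eq_complement flip: A'_set_order_eq)
  then have Ah: "A_set G X \<phi> h q = topspace X - \<Union>\<W>\<^sub>h"
    unfolding assms(3) A_set_order_coordinates[OF h(1)] \<W>\<^sub>h_def by auto
  \<comment> \<open>Closedness and invariance of \<open>Z\<close> and the cover of its complement all come from this.\<close>
  have Z: "Z = topspace X - \<Union>(\<W>\<^sub>f \<union> \<W>\<^sub>h)"
    unfolding Z_def A'f Ah by auto
  have pieces: "genus_piece G \<phi> X W" if "W \<in> \<W>\<^sub>f \<union> \<W>\<^sub>h" for W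
    using that assms(6,11) h(2) genus_piece_gap_set by (auto simp: \<W>\<^sub>f_def \<W>\<^sub>h_def)
  have fin: "finite (\<W>\<^sub>f \<union> \<W>\<^sub>h)"
    by (simp add: \<W>\<^sub>f_def \<W>\<^sub>h_def)
  have "closedin X Z"
    unfolding Z using pieces by (intro closedin_diff openin_Union) (auto simp: genus_piece_def)
  have "invariant (topspace X)"
    using act_in by (auto simp: invariant_def)
  then have inv: "invariant Z"
    unfolding Z using pieces genus_piece_invariant by (intro invariant_Diff invariant_Union) blast+
  have "card \<W>\<^sub>f \<le> k - 1" "card \<W>\<^sub>h \<le> (m - 1) * (order G - 1)"
    unfolding \<W>\<^sub>f_def \<W>\<^sub>h_def
    using card_image_le[of "{1..<k}"] card_image_le[of "{..<m - 1} \<times> {1..<order G}"] by fastforce+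
  then have card: "card (\<W>\<^sub>f \<union> \<W>\<^sub>h) \<le> (order G - 1) * (m - 1) + (k - 1)"
    using card_Un_le[of \<W>\<^sub>f \<W>\<^sub>h] by (simp add: mult.commute)
  have "genus G \<phi> X \<le> genus G \<phi> (subtopology X Z) + enat (card (\<W>\<^sub>f \<union> \<W>\<^sub>h))"
  proof (rule genus_le_closed_plus_cover_of_complement)
    show "normal_space X"
      using assms(7) by (rule paracompact_imp_normal_space)
    show "topspace X - Z \<subseteq> \<Union>(\<W>\<^sub>f \<union> \<W>\<^sub>h)"
      unfolding Z by auto
  qed (use \<open>closedin X Z\<close> inv fin pieces in auto)
  then have "genus G \<phi> X - enat ((order G - 1) * (m - 1)) - enat k + 1 \<le> genus G \<phi> (subtopology X Z)"
    using card assms(5,10)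
    by (cases "genus G \<phi> X"; cases "genus G \<phi> (subtopology X Z)") (auto simp: one_enat_def)
  moreover have "Z \<subseteq> A_set G X \<phi> (map_oplus f\<^sub>1 h) k"
  proof
    fix x assume "x \<in> Z"
    then obtain g c where x: "x \<in> topspace X" and g: "inj_on g {1..k}" "g ` {1..k} \<subseteq> carrier G"
        "\<forall>i\<in>{1..k}. f\<^sub>1 (\<phi> (g i) x) = c"
        and eq: "\<forall>a\<in>carrier G. \<forall>b\<in>carrier G. h (\<phi> a x) = h (\<phi> b x)"
      unfolding Z_def assms(3) Int_iff A_set_order_iff A'_set_def by blast
    have "map_oplus f\<^sub>1 h (\<phi> (g i) x) = map_oplus f\<^sub>1 h (\<phi> (g j) x)"
      if "i \<in> {1..k}" "j \<in> {1..k}" for i j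
    proof -
      have "g i \<in> carrier G" "g j \<in> carrier G"
        using that g(2) by auto
      then have "h (\<phi> (g i) x) = h (\<phi> (g j) x)"
        using eq by blast
      moreover have "f\<^sub>1 (\<phi> (g i) x) = f\<^sub>1 (\<phi> (g j) x)"
        using that g(3) by simp
      ultimately show ?thesis
        by (simp only: map_oplus_def)
    qed
    then show "x \<in> A_set G X \<phi> (map_oplus f\<^sub>1 h) k"
      unfolding A_set_def using x g(1,2) by blast
  qed
  then have "genus G \<phi> (subtopology X Z) \<le> genus G \<phi> (subtopology X (A_set G X \<phi> (map_oplus f\<^sub>1 h) k))"
    using inv by (rule genus_mono)
  ultimately show ?thesis
    unfolding Z_def by simp
qed

end
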